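(* In the group \(\mathcal{G}\) described below, let \(i,j,k\in\{1,\dots,14\}\) be indices whose images \(\bar i,\bar j,\bar k\) under the map \(m\mapsto m\) for \(m\le 7\), \(m\mapsto m-7\) for \(m\ge 8\), are three distinct collinear points of the Fano plane. Then there exists \(\gamma_{i,j,k}\in\mathcal{N}\) with \(\gamma_{i,j,k}=t_it_jt_kt_it_j\).
   Context: Let \(\mathcal{G}=\langle x,y,t \mid x^7, y^2, (xy)^3, [x,y]^4, t^2, [t^{x^2},yx^{-1}], [t,y], (yt^{x^2})^5, (xyx^2t^x)^5, (xt)^8\rangle\), with \(a^g=g^{-1}ag\), \([a,b]=a^{-1}b^{-1}ab\). Let \(\mathcal{N}=\langle x,y\rangle\le\mathcal{G}\); it acts on \(\{1,\dots,14\}\) on the right via \(x\mapsto(1,2,3,4,5,6,7)(8,9,10,11,12,13,14)\), \(y\mapsto(1,12)(2,3)(4,11)(5,8)(6,13)(9,10)\). Put \(t_7=t\) and \(t_i=t^g\) for any \(g\in\mathcal{N}\) mapping \(7\) to \(i\). The Fano plane has points \(1,\dots,7\) and lines \(\{7,1,5\},\{1,2,6\},\{2,3,7\},\{3,4,1\},\{4,5,2\},\{5,6,3\},\{6,7,4\}\); the point \(m\) and the index \(m+7\) lie over the same point. *)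

theory Defs
  imports Main
begin

text \<open>The finitely presented group G = < x, y, t | relators >, realised as
  words over the generators modulo the congruence generated by free
  cancellation and insertion/deletion of relators.\<close>

datatype gen = X | Y | T

text \<open>A letter (g, True) stands for g, (g, False) for g inverse.\<close>
type_synonym word = "(gen \<times> bool) list"

definition inv_word :: "word \<Rightarrow> word" where
  "inv_word w = rev (map (\<lambda>(g, b). (g, \<not> b)) w)"

definition pw :: "word \<Rightarrow> nat \<Rightarrow> word" where
  "pw w n = concat (replicate n w)"

definition comm :: "word \<Rightarrow> word \<Rightarrow> word" where
  "comm a b = inv_word a @ inv_word b @ a @ b"

definition cnj :: "word \<Rightarrow> word \<Rightarrow> word" where
  "cnj a g = inv_word g @ a @ g"

definition wx :: word where "wx = [(X, True)]"
definition wy :: word where "wy = [(Y, True)]"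
definition wt :: word where "wt = [(T, True)]"

definition relators :: "word list" where
  "relators =
    [ pw wx 7,
      pw wy 2,
      pw (wx @ wy) 3,
      pw (comm wx wy) 4,
      pw wt 2,
      comm (cnj wt (pw wx 2)) (wy @ inv_word wx),
      comm wt wy,
      pw (wy @ cnj wt (pw wx 2)) 5,
      pw (wx @ wy @ pw wx 2 @ cnj wt wx) 5,
      pw (wx @ wt) 8 ]"

inductive geq :: "word \<Rightarrow> word \<Rightarrow> bool" where
  geq_refl: "geq u u"
| geq_sym: "geq u v \<Longrightarrow> geq v u"
| geq_trans: "geq u v \<Longrightarrow> geq v w \<Longrightarrow> geq u w"
| geq_cancel: "geq (u @ [(g, b), (g, \<not> b)] @ v) (u @ v)"
| geq_rel: "r \<in> set relators \<Longrightarrow> geq (u @ r @ v) (u @ v)"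

text \<open>Words in x, y only: they represent exactly the elements of N = <x, y>.\<close>
definition N_word :: "word \<Rightarrow> bool" where
  "N_word w \<longleftrightarrow> (\<forall>l \<in> set w. fst l \<noteq> T)"

definition xperm :: "nat \<Rightarrow> nat" where
  "xperm p = (if 1 \<le> p \<and> p \<le> 6 then p + 1 else if p = 7 then 1
              else if 8 \<le> p \<and> p \<le> 13 then p + 1 else if p = 14 then 8 else p)"

definition xperm_inv :: "nat \<Rightarrow> nat" where
  "xperm_inv p = (if 2 \<le> p \<and> p \<le> 7 then p - 1 else if p = 1 then 7
              else if 9 \<le> p \<and> p \<le> 14 then p - 1 else if p = 8 then 14 else p)"

definition yperm :: "nat \<Rightarrow> nat" where
  "yperm p = (if p = 1 then 12 else if p = 12 then 1
              else if p = 2 then 3 else if p = 3 then 2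
              else if p = 4 then 11 else if p = 11 then 4
              else if p = 5 then 8 else if p = 8 then 5
              else if p = 6 then 13 else if p = 13 then 6
              else if p = 9 then 10 else if p = 10 then 9 else p)"

fun letter_act :: "gen \<times> bool \<Rightarrow> nat \<Rightarrow> nat" where
  "letter_act (X, True) p = xperm p"
| "letter_act (X, False) p = xperm_inv p"
| "letter_act (Y, _) p = yperm p"
| "letter_act (T, _) p = p"

definition act :: "nat \<Rightarrow> word \<Rightarrow> nat" where
  "act p w = foldl (\<lambda>q l. letter_act l q) p w"

text \<open>t_i = t^g for g in N with 7^g = i.\<close>
definition t_of :: "word \<Rightarrow> word" where
  "t_of g = cnj wt g"

definition bar :: "nat \<Rightarrow> nat" where
  "bar m = (if m \<le> 7 then m else m - 7)"

definition fano_lines :: "nat set set" where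
  "fano_lines = {{7,1,5}, {1,2,6}, {2,3,7}, {3,4,1}, {4,5,2}, {5,6,3}, {6,7,4}}"

end

theory Submission
  imports Defs
begin

text \<open>
  Conjugation by N permutes the fourteen involutions \<open>t_i\<close> exactly as N acts on the
  indices, so every word in them can be treated as a word in the letters 1, ..., 14, up to
  multiplication by N on the left. The relators \<open>(y t_2)^5\<close> and
  \<open>(x y x^2 t_1)^5\<close> say that \<open>t_2 t_3 t_2 t_3 t_2\<close> and
  \<open>t_1 t_12 t_8 t_5 t_1\<close> lie in N. Inserting eleven conjugates
  of these two relators turns the empty word into 7 1 5 7 1 and into 7 1 12 7 1. Every
  admissible triple (i, j, k) is the image under N of (7, 1, 5) or of (7, 1, 12), which proves
  the theorem.
\<close>

section \<open>The presented group as a quotient of words\<close>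

lemma geq_append:
  assumes "geq u u'" "geq v v'"
  shows "geq (u @ v) (u' @ v')"
proof -
  \<comment> \<open>\<open>geq_cancel\<close> and \<open>geq_rel\<close> already allow an arbitrary
    context on both sides, so appending or prepending a word only enlarges that context.\<close>
  have right: "geq (a @ c) (b @ c)" if "geq a b" for a b c
    using that
  proof induction
    case (geq_cancel u g b v)
    then show ?case using geq.geq_cancel[of u g b "v @ c"] by simp
  next
    case (geq_rel r u v)
    then show ?case using geq.geq_rel[of r u "v @ c"] by simp
  qed (auto intro: geq.intros)
  have left: "geq (c @ a) (c @ b)" if "geq a b" for a b c
    using that
  proof induction
    case (geq_cancel u g b v)
    then show ?case using geq.geq_cancel[of "c @ u" g b v] by simp
  next
    case (geq_rel r u v)
    then show ?case using geq.geq_rel[of r "c @ u" v] by simp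
  qed (auto intro: geq.intros)
  show ?thesis
    using left right assms by (blast intro: geq_trans)
qed

lemma inv_word_append: "inv_word (u @ v) = inv_word v @ inv_word u"
  by (simp add: inv_word_def)

lemma inv_word_inv_word [simp]: "inv_word (inv_word u) = u"
  by (simp add: inv_word_def rev_map o_def split_def)

lemma geq_inv_left: "geq (inv_word u @ u) []"
proof (induction u)
  case (Cons l u)
  obtain g b where l: "l = (g, b)" by force
  have "geq (inv_word (l # u) @ l # u) (inv_word u @ u)"
    using geq_cancel[of "inv_word u" g "\<not> b" u] by (simp add: inv_word_def l)
  with Cons show ?case by (blast intro: geq_trans)
qed (simp add: inv_word_def geq_refl)

lemma geq_inv_word:
  assumes "geq u v"
  shows "geq (inv_word u) (inv_word v)"
proof -
  \<comment> \<open>The chain u^-1 = u^-1 v v^-1 = u^-1 u v^-1 = v^-1 avoids an induction on the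
    derivation, in which inverted relators would appear.\<close>
  have "geq (inv_word u) (inv_word u @ v @ inv_word v)"
    using geq_append[OF geq_refl[of "inv_word u"] geq_sym[OF geq_inv_left[of "inv_word v"]]] by simp
  moreover have "geq (inv_word u @ v @ inv_word v) (inv_word u @ u @ inv_word v)"
    using assms by (intro geq_append geq_refl geq_sym[OF assms])
  moreover have "geq (inv_word u @ u @ inv_word v) (inv_word v)"
    using geq_append[OF geq_inv_left[of u] geq_refl[of "inv_word v"]] by simp
  ultimately show ?thesis by (blast intro: geq_trans)
qed

quotient_type grp = word / geq
  by (intro equivpI reflpI sympI transpI) (blast intro: geq.intros)+

instantiation grp :: "{monoid_mult, inverse}"
begin

lift_definition one_grp :: grp is "[]" .
lift_definition times_grp :: "grp \<Rightarrow> grp \<Rightarrow> grp" is "(@)" by (rule geq_append)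
lift_definition inverse_grp :: "grp \<Rightarrow> grp" is inv_word by (rule geq_inv_word)
definition divide_grp :: "grp \<Rightarrow> grp \<Rightarrow> grp" where "divide_grp a b = a * inverse b"

instance
  by standard (transfer; simp add: geq_refl)+

end

lift_definition val :: "word \<Rightarrow> grp" is "\<lambda>w. w" .

lemma val_eq_iff: "val u = val v \<longleftrightarrow> geq u v"
  by transfer simp

lemma val_Nil [simp]: "val [] = 1"
  by transfer (rule geq_refl)

lemma val_append [simp]: "val (u @ v) = val u * val v"
  by transfer (rule geq_refl)

lemma val_inv_word [simp]: "val (inv_word u) = inverse (val u)"
  by transfer (rule geq_refl)

lemma val_pw [simp]: "val (pw u n) = val u ^ n"
  by (induction n) (simp_all add: pw_def)

lemma grp_left_inverse [simp]: "inverse a * a = 1" for a :: grp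
  by transfer (rule geq_inv_left)

lemma grp_right_inverse [simp]: "a * inverse a = 1" for a :: grp
  by transfer (metis geq_inv_left inv_word_inv_word)

lemma grp_left_inverse' [simp]: "inverse a * (a * b) = b" for a b :: grp
  by (simp flip: mult.assoc)

lemma grp_right_inverse' [simp]: "a * (inverse a * b) = b" for a b :: grp
  by (simp flip: mult.assoc)

lemma grp_inverse_unique: "a * b = 1 \<Longrightarrow> inverse a = b" for a b :: grp
  by (metis grp_left_inverse' mult.right_neutral)

lemma grp_inverse_mult: "inverse (a * b) = inverse b * inverse a" for a b :: grp
  by (rule grp_inverse_unique) (simp add: mult.assoc)

section \<open>Conjugation, and the relators as equations\<close>

definition conjugate :: "grp \<Rightarrow> grp \<Rightarrow> grp" where
  "conjugate a g = inverse g * a * g"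

lemma conjugate_mult: "conjugate a (g * h) = conjugate (conjugate a g) h"
  by (simp add: conjugate_def grp_inverse_mult mult.assoc)

lemma conjugate_one [simp]: "conjugate a 1 = a"
  by (metis conjugate_def grp_left_inverse mult.left_neutral mult.right_neutral)

lemma conjugate_eq_iff: "conjugate a g = b \<longleftrightarrow> a * g = g * b"
  by (metis conjugate_def grp_left_inverse' grp_right_inverse' mult.assoc)

abbreviation xG :: grp where "xG \<equiv> val wx"
abbreviation yG :: grp where "yG \<equiv> val wy"
abbreviation tG :: grp where "tG \<equiv> val wt"

lemma val_relator: "r \<in> set relators \<Longrightarrow> val r = 1"
  using geq_rel[of r "[]" "[]"] by (simp add: val_eq_iff flip: val_Nil)

text \<open>The commutator relators involving t are recast as fixed points of conjugation, the form
  in which they act on the involutions.\<close>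

lemma presentation:
  "xG ^ 7 = 1" "yG ^ 2 = 1" "(xG * yG) ^ 3 = 1"
  "(inverse xG * inverse yG * xG * yG) ^ 4 = 1" "tG ^ 2 = 1"
  "conjugate (conjugate tG (xG ^ 2)) (yG * inverse xG) = conjugate tG (xG ^ 2)" "conjugate tG yG = tG"
  "(yG * conjugate tG (xG ^ 2)) ^ 5 = 1" "(xG * yG * xG ^ 2 * conjugate tG xG) ^ 5 = 1"
proof -
  have comm: "val (comm a b) = 1 \<Longrightarrow> conjugate (val a) (val b) = val a" for a b
    by (simp add: comm_def conjugate_eq_iff)
      (metis grp_right_inverse' mult.assoc mult.right_neutral)
  have cnj: "val (cnj a b) = conjugate (val a) (val b)" for a b
    by (simp add: cnj_def conjugate_def mult.assoc)
  note rel = val_relator[unfolded relators_def]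
  show "xG ^ 7 = 1" "yG ^ 2 = 1" "(xG * yG) ^ 3 = 1" "tG ^ 2 = 1"
    using rel[of "pw wx 7"] rel[of "pw wy 2"] rel[of "pw (wx @ wy) 3"] rel[of "pw wt 2"] by simp_all
  show "(inverse xG * inverse yG * xG * yG) ^ 4 = 1"
    using rel[of "pw (comm wx wy) 4"] by (simp add: comm_def mult.assoc)
  show "conjugate (conjugate tG (xG ^ 2)) (yG * inverse xG) = conjugate tG (xG ^ 2)"
    using comm[OF rel, of "cnj wt (pw wx 2)" "wy @ inv_word wx"] by (simp add: cnj)
  show "conjugate tG yG = tG"
    using comm[OF rel, of wt wy] by simp
  show "(yG * conjugate tG (xG ^ 2)) ^ 5 = 1" "(xG * yG * xG ^ 2 * conjugate tG xG) ^ 5 = 1"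
    using rel[of "pw (wy @ cnj wt (pw wx 2)) 5"] rel[of "pw (wx @ wy @ pw wx 2 @ cnj wt wx) 5"]
    by (simp_all add: cnj mult.assoc)
qed

section \<open>The fourteen involutions and their images under x and y\<close>

lemma atLeastAtMost_1_14: "{1..14::nat} = {1, 2, 3, 4, 5, 6, 7, 8, 9, 10, 11, 12, 13, 14}"
proof -
  have "{1..14::nat} = insert 1 (set [2..<15])"
    unfolding set_upt by auto
  then show ?thesis by simp
qed

lemma conjugate_inverse_iff: "conjugate a (inverse g) = b \<longleftrightarrow> conjugate b g = a"
  by (metis conjugate_mult conjugate_one grp_left_inverse grp_right_inverse)

lemma conjugate_conjugate_inverse [simp]: "conjugate (conjugate a g) (inverse g) = a"
  by (simp add: conjugate_inverse_iff)

lemma conjugate_of_one [simp]: "conjugate 1 g = 1"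
  by (simp add: conjugate_def)

text \<open>The element t_i: x ^ i maps 7 to i if i \<le> 7, and x ^ 5 y x ^ (i - 8) does so if
  i \<ge> 8. Outside the range 1, ..., 14, which all letters fix, it is 1.\<close>
definition invol :: "nat \<Rightarrow> grp" where
  "invol i = (if i \<in> {1..7} then conjugate tG (xG ^ i)
          else if i \<in> {8..14} then conjugate tG (xG ^ 5 * yG * xG ^ (i - 8)) else 1)"

lemma invol_7: "invol 7 = tG"
  by (simp add: invol_def presentation)

lemma invol_square [simp]: "invol i * invol i = 1"
proof -
  have "tG * tG = 1" using presentation(5) by (simp add: power2_eq_square)
  then have "conjugate tG g * conjugate tG g = 1" for g
    by (simp add: conjugate_def mult.assoc) (metis grp_left_inverse mult.assoc mult.left_neutral)
  then show ?thesis by (simp add: invol_def)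
qed

lemma invol_x: "conjugate (invol i) xG = invol (xperm i)"
proof -
  \<comment> \<open>Needed for the wraparound from 14 to 8: x^5 y x^6 x = x^5 y.\<close>
  have x7: "g * xG ^ 6 * xG = g" for g
    using presentation(1) by (simp add: mult.assoc flip: power_Suc2)
  consider "i \<in> {1..6}" | "i = 7" | "i \<in> {8..13}" | "i = 14" | "i \<notin> {1..14}"
    by fastforce
  then show ?thesis
  proof cases
    case 1
    then show ?thesis by (simp add: invol_def xperm_def power_Suc2 flip: conjugate_mult del: power_Suc)
  next
    case 2
    then show ?thesis by (simp add: invol_7 xperm_def) (simp add: invol_def)
  next
    case 3
    then have "i \<ge> 8" by simp
    then have "i - 7 = Suc (i - 8)" by arith
    with 3 show ?thesis
      by (simp add: invol_def xperm_def power_Suc2 mult.assoc flip: conjugate_mult del: power_Suc)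
  next
    case 4
    then show ?thesis
      using x7[of "xG ^ 5 * yG"] by (simp add: invol_def xperm_def mult.assoc flip: conjugate_mult)
  qed (auto simp: invol_def xperm_def)
qed

text \<open>The definition and the relators involving t give the images of 2, 3, 5, 7 and 8. The
  braid relation from (x y) ^ 3 expresses those of 1, 4, 6 and 14 as translates of a = t_9 ^ y
  under x, and then [x, y] ^ 4 at t_3 gives a = t_10.\<close>
lemma invol_y: "conjugate (invol i) yG = invol (yperm i)"
proof -
  define a where "a = conjugate (invol 9) yG"
  have x: "conjugate (invol 1) xG = invol 2" "conjugate (invol 2) xG = invol 3"
    "conjugate (invol 3) xG = invol 4"
    "conjugate (invol 4) xG = invol 5" "conjugate (invol 5) xG = invol 6"
    "conjugate (invol 6) xG = invol 7"
    "conjugate (invol 7) xG = invol 1" "conjugate (invol 8) xG = invol 9"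
    "conjugate (invol 9) xG = invol 10"
    "conjugate (invol 10) xG = invol 11" "conjugate (invol 11) xG = invol 12"
    "conjugate (invol 12) xG = invol 13"
    "conjugate (invol 13) xG = invol 14" "conjugate (invol 14) xG = invol 8"
    by (simp_all add: invol_x xperm_def del: One_nat_def)
  have xi: "conjugate (invol 1) (inverse xG) = invol 7" "conjugate (invol 3) (inverse xG) = invol 2"
    "conjugate (invol 4) (inverse xG) = invol 3" "conjugate (invol 5) (inverse xG) = invol 4"
    "conjugate (invol 7) (inverse xG) = invol 6" "conjugate (invol 8) (inverse xG) = invol 14"
    "conjugate (invol 2) (inverse xG) = invol 1" "conjugate (invol 6) (inverse xG) = invol 5"
    by (simp_all add: conjugate_inverse_iff x del: One_nat_def)
  have yy: "yG * yG = 1" using presentation(2) by (simp add: power2_eq_square)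
  then have yy': "yG * (yG * g) = g" for g by (simp flip: mult.assoc)
  have yi: "inverse yG = yG" by (rule grp_inverse_unique) (rule yy)
  have y_swap: "conjugate u yG = v \<Longrightarrow> conjugate v yG = u" for u v
    by (metis conjugate_mult conjugate_one yy)
  have yxy: "yG * xG * yG = inverse xG * yG * inverse xG"
  proof -
    have "xG * (yG * xG * yG) * xG * yG = 1"
      using presentation(3) by (simp add: power3_eq_cube mult.assoc)
    then have "inverse (xG * (yG * xG * yG)) = xG * yG"
      by (intro grp_inverse_unique) (simp add: mult.assoc)
    then have "inverse (inverse (xG * (yG * xG * yG))) = yG * inverse xG"
      by (simp add: grp_inverse_mult yi)
    moreover have "inverse (inverse g) = g" for g :: grp
      by (rule grp_inverse_unique) simp
    ultimately have "inverse xG * (xG * (yG * xG * yG)) = inverse xG * (yG * inverse xG)"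
      by simp
    then show ?thesis by (simp add: mult.assoc)
  qed
  \<comment> \<open>Since y x y x = x^-1 y, the image under y of the x-predecessor of u is obtained
    from u^y by applying x, y, x in turn.\<close>
  have braid: "conjugate (conjugate (conjugate (conjugate u yG) xG) yG) xG
      = conjugate (conjugate u (inverse xG)) yG" for u
    using arg_cong[OF yxy, of "\<lambda>g. conjugate u (g * xG)"]
    by (simp add: mult.assoc flip: conjugate_mult)
  have y7: "conjugate (invol 7) yG = invol 7" by (simp add: invol_7 presentation)
  \<comment> \<open>The relator says that y x^-1 fixes t_2, so y and x agree on t_2.\<close>
  have y2: "conjugate (invol 2) yG = invol 3"
    using presentation(6) x(2) by (simp add: invol_def conjugate_mult conjugate_inverse_iff)
  note y3 = y_swap[OF y2]
  have y5: "conjugate (invol 5) yG = invol 8" by (simp add: invol_def flip: conjugate_mult)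
  note y8 = y_swap[OF y5]
  have y4: "conjugate (invol 4) yG = conjugate a xG"
    using braid[of "invol 5"] by (simp add: y5 x xi a_def del: One_nat_def)
  have y1: "conjugate (invol 1) yG = conjugate (conjugate a xG) xG"
    using braid[of "invol 2"] by (simp add: y2 x xi y4 del: One_nat_def)
  have y6: "conjugate (invol 6) yG = conjugate (conjugate (conjugate a xG) xG) xG"
    using braid[of "invol 7"] by (simp add: y7 x xi y1 del: One_nat_def)
  have y14: "conjugate (invol 14) yG = conjugate (conjugate (conjugate (conjugate a xG) xG) xG) xG"
    using braid[of "invol 8"] by (simp add: y8 x xi y6 del: One_nat_def)
  have a_y: "conjugate a yG = invol 9" by (rule y_swap) (simp add: a_def)
  define c where "c = inverse xG * yG * xG * yG"
  \<comment> \<open>Here c = [x, y], so c^4 = 1 gives c^2 = c^-2. Both sides can be followed from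
    t_3 with the images known so far: the left one ends at \<open>t_10 ^ y\<close>, the right one at
    t_9.\<close>
  have cc: "conjugate (invol 3) (c * c) = conjugate (conjugate (invol 3) (inverse c)) (inverse c)"
  proof -
    have "c * c * c * c = 1"
      using presentation(4) by (simp add: c_def yi numeral_eq_Suc mult.assoc)
    then have "c * c = inverse c * inverse c"
      by (metis grp_inverse_mult grp_inverse_unique mult.assoc)
    then show ?thesis by (simp add: conjugate_mult)
  qed
  have inv_c: "inverse c = yG * inverse xG * yG * xG"
    by (rule grp_inverse_unique) (simp add: c_def mult.assoc yy yy')
  have "conjugate (invol 3) (c * c) = conjugate (invol 10) yG"
    by (simp add: c_def conjugate_mult x xi y2 y3 y4 a_y conjugate_conjugate_inverse del: One_nat_def)
  moreover have "conjugate (conjugate (invol 3) (inverse c)) (inverse c) = invol 9"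
    by (simp add: inv_c conjugate_mult x xi y3 y1 y_swap[OF y6] y5 del: One_nat_def)
  ultimately have y10: "conjugate (invol 10) yG = invol 9"
    using cc by simp
  have a: "a = invol 10"
    using y_swap[OF y10] by (simp add: a_def)
  consider "i \<in> {1..14}" | "i \<notin> {1..14}" by blast
  then show ?thesis
  proof cases
    case 1
    then have i: "i \<in> {1, 2, 3, 4, 5, 6, 7, 8, 9, 10, 11, 12, 13, 14}" unfolding atLeastAtMost_1_14 .
    note y = y1 y2 y3 y4 y5 y6 y7 y8 y14 a_y a_def[symmetric]
      y_swap[OF y1] y_swap[OF y4] y_swap[OF y6]
    from i show ?thesis
      by (elim insertE emptyE) (simp_all add: yperm_def y[unfolded a x] del: One_nat_def)
  next
    case 2
    then have "invol i = 1" "yperm i = i" by (auto simp: invol_def yperm_def)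
    then show ?thesis by simp
  qed
qed

section \<open>Words in x and y acting on the involutions\<close>

lemma xperm_xperm_inv: "xperm (xperm_inv i) = i"
proof (cases "i \<in> {1..14}")
  case True
  then have "i \<in> {1, 2, 3, 4, 5, 6, 7, 8, 9, 10, 11, 12, 13, 14}" unfolding atLeastAtMost_1_14 .
  then show ?thesis by (elim insertE emptyE) (simp_all add: xperm_def xperm_inv_def)
next
  case False
  then have "xperm_inv i = i" "xperm i = i" by (auto simp: xperm_def xperm_inv_def)
  then show ?thesis by simp
qed

lemma act_append: "act i (u @ v) = act (act i u) v"
  by (simp add: act_def)

lemma act_Nil [simp]: "act i [] = i"
  by (simp add: act_def)

lemma act_Cons: "act i (l # w) = act (letter_act l i) w"
  by (simp add: act_def)

lemma N_word_simps [simp]: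
  "N_word []" "N_word wx" "N_word wy"
  "N_word (u @ v) \<longleftrightarrow> N_word u \<and> N_word v"
  "N_word (inv_word u) \<longleftrightarrow> N_word u"
  by (auto simp: N_word_def inv_word_def wx_def wy_def)

lemma N_word_pw [simp]: "N_word u \<Longrightarrow> N_word (pw u n)"
  by (auto simp: N_word_def pw_def)

lemma N_word_cnj [simp]: "N_word u \<Longrightarrow> N_word g \<Longrightarrow> N_word (cnj u g)"
  by (simp add: cnj_def)

lemma val_cnj [simp]: "val (cnj a g) = conjugate (val a) (val g)"
  by (simp add: cnj_def conjugate_def mult.assoc)

text \<open>Letter by letter from \<open>invol_x\<close> and \<open>invol_y\<close>; conjugation and
  \<open>act\<close> are both right actions, so the order of the letters agrees. Inverse letters use
  that \<open>xperm_inv\<close> undoes \<open>xperm\<close> and that y is an involution.\<close>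

lemma conjugate_invol: "N_word w \<Longrightarrow> conjugate (invol i) (val w) = invol (act i w)"
proof (induction w arbitrary: i)
  case (Cons l w)
  obtain g b where l: "l = (g, b)" by force
  have y: "inverse yG = yG"
    using presentation(2) by (intro grp_inverse_unique) (simp add: power2_eq_square)
  have "conjugate (invol i) (val [l]) = invol (letter_act l i)"
  proof (cases g)
    case X
    moreover have "val [(X, False)] = inverse xG"
      by (simp add: inv_word_def wx_def flip: val_inv_word)
    ultimately show ?thesis
      using invol_x[of i] by (cases b) (simp_all add: l conjugate_inverse_iff invol_x xperm_xperm_inv flip: wx_def)
  next
    case Y
    moreover have "val [(Y, False)] = inverse yG"
      by (simp add: inv_word_def wy_def flip: val_inv_word)
    ultimately show ?thesis
      using invol_y[of i] by (cases b) (simp_all add: l y flip: wy_def)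
  next
    case T
    with Cons.prems show ?thesis by (simp add: N_word_def l)
  qed
  moreover have "val (l # w) = val [l] * val w"
    using val_append[of "[l]" w] by simp
  ultimately show ?case
    using Cons by (simp add: conjugate_mult act_Cons N_word_def)
qed simp

text \<open>Makes t_i independent of the chosen g, so the conjugating words in the theorem may be
  arbitrary.\<close>

lemma val_t_of: "N_word g \<Longrightarrow> act 7 g = i \<Longrightarrow> val (t_of g) = invol i"
  using conjugate_invol[of g 7] by (simp add: t_of_def invol_7)

section \<open>Words in the involutions modulo N on the left\<close>

definition prods :: "nat list \<Rightarrow> grp" where
  "prods u = prod_list (map invol u)"

lemma prods_simps [simp]:
  "prods [] = 1" "prods (i # u) = invol i * prods u" "prods (u @ v) = prods u * prods v"
  by (simp_all add: prods_def)

text \<open>Repeated use of t_i w = w t_j, with j the image of i under w, carries w to the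
  front.\<close>

lemma prods_act:
  assumes "N_word w"
  shows "prods u * val w = val w * prods (map (\<lambda>i. act i w) u)"
proof (induction u)
  case (Cons i u)
  have "invol i * val w = val w * invol (act i w)"
    using conjugate_invol[OF assms] by (simp add: conjugate_eq_iff)
  with Cons show ?case by (metis list.simps(9) mult.assoc prods_simps(2))
qed simp

text \<open>The letters that remain when the five factors w of \<open>(w t_i)^5\<close> are
  collected on the left: the leftmost t_i is passed by four of them, the rightmost by none.\<close>

definition orbit_word :: "word \<Rightarrow> nat \<Rightarrow> nat list" where
  "orbit_word w i = map (\<lambda>k. act i (pw w k)) [4, 3, 2, 1, 0]"

lemma fifth_power:
  assumes "N_word w"
  shows "(val w * invol i) ^ 5 = val w ^ 5 * prods (orbit_word w i)"
proof -
  have pw_Suc: "pw w k @ w = pw w (Suc k)" for k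
    by (induction k) (simp_all add: pw_def)
  have "(val w * invol i) ^ n = val w ^ n * prods (map (\<lambda>k. act i (pw w k)) (rev [0..<n]))" for n
  proof (induction n)
    case (Suc n)
    \<comment> \<open>One more factor w passes all earlier letters and raises their exponents by
      one; the new t_i gets exponent 0.\<close>
    have *: "map (\<lambda>k. act i (pw w k)) (rev [0..<Suc n])
        = map (\<lambda>j. act j w) (map (\<lambda>k. act i (pw w k)) (rev [0..<n])) @ [i]"
      by (simp add: upt_conv_Cons pw_Suc pw_def[of w 0] o_def rev_map
            flip: map_Suc_upt act_append del: upt_Suc)
    have "(val w * invol i) ^ Suc n
        = val w ^ n * (prods (map (\<lambda>k. act i (pw w k)) (rev [0..<n])) * val w) * invol i"
      by (simp only: power_Suc2 Suc mult.assoc)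
    then show ?case
      by (simp only: * prods_act[OF assms] prods_simps power_Suc2 mult.assoc mult_1_right)
  qed simp
  from this[of 5] show ?thesis
    by (simp add: orbit_word_def upt_rec numeral_eq_Suc)
qed

text \<open>Equality of the right cosets of N containing the two products. The theorem amounts to
  \<open>[i, j, k, i, j]\<close> lying in the coset of the empty word.\<close>

definition coset_eq :: "nat list \<Rightarrow> nat list \<Rightarrow> bool" where
  "coset_eq u v \<longleftrightarrow> (\<exists>w. N_word w \<and> prods u = val w * prods v)"

lemma coset_eq_refl: "coset_eq u u"
  unfolding coset_eq_def by (rule exI[of _ "[]"]) simp

lemma coset_eq_sym: "coset_eq u v \<Longrightarrow> coset_eq v u"
  unfolding coset_eq_def by (metis N_word_simps(5) grp_left_inverse' val_inv_word)

lemma coset_eq_trans: "coset_eq u v \<Longrightarrow> coset_eq v w \<Longrightarrow> coset_eq u w"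
  unfolding coset_eq_def by (metis N_word_simps(4) mult.assoc val_append)

text \<open>Relabelling by c is conjugation by an element of N, which maps N to itself: the factor w
  turns into its conjugate by c.\<close>

lemma coset_eq_act:
  assumes "coset_eq u v" "N_word c"
  shows "coset_eq (map (\<lambda>i. act i c) u) (map (\<lambda>i. act i c) v)"
proof -
  obtain w where w: "N_word w" "prods u = val w * prods v"
    using assms(1) by (auto simp: coset_eq_def)
  have "val c * prods (map (\<lambda>i. act i c) u) = val w * (val c * prods (map (\<lambda>i. act i c) v))"
    using prods_act[OF assms(2)] w(2) by (metis mult.assoc)
  then have "prods (map (\<lambda>i. act i c) u) = val (cnj w c) * prods (map (\<lambda>i. act i c) v)"
    by (simp add: conjugate_def mult.assoc) (metis grp_left_inverse')
  with w assms show ?thesis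
    unfolding coset_eq_def by (intro exI[of _ "cnj w c"]) simp
qed

text \<open>The trivial element \<open>(w t_i)^5\<close>, written as w^5 times its orbit word, is
  put between u and v; w^5 then passes u and is absorbed by N.\<close>

lemma coset_eq_insert:
  assumes "N_word w" "(val w * invol i) ^ 5 = 1"
  shows "coset_eq (u @ v) (map (\<lambda>j. act j (pw w 5)) u @ orbit_word w i @ v)"
proof -
  have "prods (u @ v) = prods u * val (pw w 5) * prods (orbit_word w i) * prods v"
    using assms(2) unfolding fifth_power[OF assms(1)]
    by simp (metis mult.assoc mult.left_neutral)
  also have "\<dots> = val (pw w 5) * prods (map (\<lambda>j. act j (pw w 5)) u @ orbit_word w i @ v)"
    using assms(1) prods_act[of "pw w 5" u] by (simp add: mult.assoc del: val_pw)
  finally show ?thesis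
    unfolding coset_eq_def using assms(1) by (intro exI[of _ "pw w 5"]) simp
qed

section \<open>Cancellation and the insertion of relators\<close>

fun cons_reduced :: "nat \<Rightarrow> nat list \<Rightarrow> nat list" where
  "cons_reduced i [] = [i]"
| "cons_reduced i (j # u) = (if i = j then u else i # j # u)"

lemma prods_cons_reduced: "prods (cons_reduced i u) = invol i * prods u"
proof (cases u)
  case (Cons j v)
  then show ?thesis by (simp flip: mult.assoc)
qed simp

text \<open>One pass from the right suffices, because each letter is put in front of a word that is
  already reduced.\<close>

definition reduce :: "nat list \<Rightarrow> nat list" where
  "reduce u = foldr cons_reduced u []"

lemma prods_reduce: "prods (reduce u) = prods u"
  by (induction u) (simp_all add: reduce_def prods_cons_reduced)

abbreviation px :: "gen \<times> bool" where "px \<equiv> (X, True)"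
abbreviation nx :: "gen \<times> bool" where "nx \<equiv> (X, False)"
abbreviation py :: "gen \<times> bool" where "py \<equiv> (Y, True)"

definition wxyxx :: word where "wxyxx = wx @ wy @ pw wx 2"

lemma fifth_power_relators:
  assumes "(w, i) \<in> {(wy, 2), (wxyxx, 1)}"
  shows "(val w * invol i) ^ 5 = 1"
  using assms presentation(8,9) by (auto simp: invol_def wxyxx_def mult.assoc)

text \<open>A move (p, w, i, c) inserts the relator (w t_i) ^ 5, conjugated by c, at position p.
  Its N-part w ^ 5 is pushed to the left, where it permutes the letters and is then absorbed
  by N.\<close>
fun move :: "nat \<times> word \<times> nat \<times> word \<Rightarrow> nat list \<Rightarrow> nat list" where
  "move (p, w, i, c) u =
     reduce (map (\<lambda>j. act j (pw (cnj w c) 5)) (take p u)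
       @ orbit_word (cnj w c) (act i c) @ drop p u)"

text \<open>The condition \<open>N_word c\<close> is written out so that simplification decides it
  on explicit words.\<close>

definition legal_move :: "nat \<times> word \<times> nat \<times> word \<Rightarrow> bool" where
  "legal_move m \<longleftrightarrow>
    (case m of (p, w, i, c) \<Rightarrow> (w, i) \<in> {(wy, 2), (wxyxx, 1)} \<and> (\<forall>l \<in> set c. fst l \<noteq> T))"

text \<open>Conjugating \<open>(w t_i)^5 = 1\<close> by c gives a relation of the same shape, with w
  replaced by \<open>cnj w c\<close> and i by \<open>act i c\<close>, so
  \<open>coset_eq_insert\<close> applies to it. Cancelling equal neighbours does not change the
  product.\<close>

lemma coset_eq_move:
  assumes "legal_move m"
  shows "coset_eq u (move m u)"
proof -
  obtain p w i c where m: "m = (p, w, i, c)" by (metis prod_cases4)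
  have c: "N_word c" and wi: "(w, i) \<in> {(wy, 2), (wxyxx, 1)}"
    using assms by (auto simp: m legal_move_def N_word_def)
  then have w: "N_word w" by (auto simp: wxyxx_def)
  have "val (cnj w c) * invol (act i c) = conjugate (val w * invol i) (val c)"
    by (simp add: conjugate_def mult.assoc flip: conjugate_invol[OF c])
  moreover have "conjugate a g ^ n = conjugate (a ^ n) g" for a g n
    by (induction n) (simp_all add: conjugate_def mult.assoc)
  ultimately have "(val (cnj w c) * invol (act i c)) ^ 5 = 1"
    using fifth_power_relators[OF wi] by simp
  from coset_eq_insert[OF _ this, of "take p u" "drop p u"] c w
  show ?thesis by (simp add: m coset_eq_def prods_reduce)
qed

lemma coset_eq_moves: "list_all legal_move ms \<Longrightarrow> coset_eq u (fold move ms u)"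
proof (induction ms arbitrary: u)
  case (Cons m ms)
  then show ?case by (auto intro: coset_eq_trans coset_eq_move)
qed (simp add: coset_eq_refl)

text \<open>Both chains of moves were found by breadth-first search over words of length at most 10.\<close>
definition moves_5 :: "(nat \<times> word \<times> nat \<times> word) list" where
  "moves_5 =
   [(0, wy, 2, [px, px, px, py, px, px, py]),
    (1, wy, 2, [px, px, px]),
    (5, wxyxx, 1, [px, px, px, py, px]),
    (7, wxyxx, 1, [nx, nx, nx]),
    (4, wy, 2, [px, px, py, nx, nx, nx]),
    (4, wy, 2, [nx, py, px, px, py, px]),
    (2, wxyxx, 1, [px, px, py, nx, nx, py, px]),
    (5, wy, 2, [px, px, py, px]),
    (3, wxyxx, 1, [py, px, py, nx]),
    (5, wxyxx, 1, [nx, nx, nx, py, px, px, py]),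
    (4, wy, 2, [px, px, px, py, nx, nx, nx, py])]"

definition moves_12 :: "(nat \<times> word \<times> nat \<times> word) list" where
  "moves_12 =
   [(0, wy, 2, [nx, py, px, px, py, nx, nx, nx]),
    (1, wy, 2, [px, px, px, py, nx, nx, nx]),
    (4, wxyxx, 1, [nx, nx, nx, py, px, px]),
    (6, wxyxx, 1, [px, px, px, py]),
    (5, wy, 2, [px, px, py, px, px, py, nx]),
    (3, wy, 2, [px, px, py]),
    (5, wxyxx, 1, [px, px, px]),
    (4, wy, 2, [nx, nx, py, px, py, nx]),
    (5, wxyxx, 1, [py, px, px, px, py]),
    (7, wxyxx, 1, [px, px, px]),
    (4, wy, 2, [px, py, nx, nx, py, px])]"

section \<open>Evaluation of the two chains of moves\<close>

lemma letter_act_table: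
  "letter_act px 1 = 2" "letter_act px 2 = 3" "letter_act px 3 = 4" "letter_act px 4 = 5"
  "letter_act px 5 = 6" "letter_act px 6 = 7" "letter_act px 7 = 1" "letter_act px 8 = 9"
  "letter_act px 9 = 10" "letter_act px 10 = 11" "letter_act px 11 = 12" "letter_act px 12 = 13"
  "letter_act px 13 = 14" "letter_act px 14 = 8"
  "letter_act nx 1 = 7" "letter_act nx 2 = 1" "letter_act nx 3 = 2" "letter_act nx 4 = 3"
  "letter_act nx 5 = 4" "letter_act nx 6 = 5" "letter_act nx 7 = 6" "letter_act nx 8 = 14"
  "letter_act nx 9 = 8" "letter_act nx 10 = 9" "letter_act nx 11 = 10" "letter_act nx 12 = 11"
  "letter_act nx 13 = 12" "letter_act nx 14 = 13"
  "letter_act (Y, b) 1 = 12" "letter_act (Y, b) 2 = 3" "letter_act (Y, b) 3 = 2"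
  "letter_act (Y, b) 4 = 11" "letter_act (Y, b) 5 = 8" "letter_act (Y, b) 6 = 13"
  "letter_act (Y, b) 7 = 7" "letter_act (Y, b) 8 = 5" "letter_act (Y, b) 9 = 10"
  "letter_act (Y, b) 10 = 9" "letter_act (Y, b) 11 = 4" "letter_act (Y, b) 12 = 1"
  "letter_act (Y, b) 13 = 6" "letter_act (Y, b) 14 = 14"
  by (simp_all add: xperm_def xperm_inv_def yperm_def)

lemma act_pw_5: "act i (pw w 5) = act (act (act (act (act i w) w) w) w) w"
  by (simp add: pw_def numeral_eq_Suc act_append)

lemma orbit_word_eq:
  "orbit_word w i = [act (act (act (act i w) w) w) w, act (act (act i w) w) w, act (act i w) w, act i w, i]"
  by (simp add: orbit_word_def pw_def numeral_eq_Suc act_append)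

lemma act_cnj: "act i (cnj w c) = act (act (act i (inv_word c)) w) c"
  by (simp add: cnj_def act_append)

lemma act_wy: "act i wy = letter_act py i"
  by (simp add: wy_def act_Cons)

lemma act_wxyxx: "act i wxyxx = letter_act px (letter_act px (letter_act py (letter_act px i)))"
  by (simp add: wxyxx_def wx_def wy_def pw_def numeral_eq_Suc act_append act_Cons)

lemmas move_eval = move.simps reduce_def act_pw_5 orbit_word_eq act_cnj act_wy act_wxyxx
  inv_word_def act_Cons letter_act_table take_Cons' drop_Cons'

text \<open>The two chains serve as certificates: every move preserves the coset, and rewriting
  computes the final word.\<close>

lemma coset_eq_move_chains:
  "coset_eq [] [7, 1, 5, 7, 1]" "coset_eq [] [7, 1, 12, 7, 1]"
proof -
  have "fold move moves_5 [] = [7, 1, 5, 7, 1]"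
    \<comment> \<open>The deletions keep 1 from becoming \<open>Suc 0\<close> and
      \<open>letter_act\<close> from being unfolded before the table can apply.\<close>
    by (simp add: moves_5_def move_eval del: One_nat_def letter_act.simps)
  moreover have "list_all legal_move moves_5"
    by (simp add: moves_5_def legal_move_def)
  ultimately show "coset_eq [] [7, 1, 5, 7, 1]"
    using coset_eq_moves[of moves_5 "[]"] by simp
  have "fold move moves_12 [] = [7, 1, 12, 7, 1]"
    by (simp add: moves_12_def move_eval del: One_nat_def letter_act.simps)
  moreover have "list_all legal_move moves_12"
    by (simp add: moves_12_def legal_move_def)
  ultimately show "coset_eq [] [7, 1, 12, 7, 1]"
    using coset_eq_moves[of moves_12 "[]"] by simp
qed

section \<open>The Fano plane and the action of N on collinear triples\<close>

lemma bar_table: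
  "bar 1 = 1" "bar 2 = 2" "bar 3 = 3" "bar 4 = 4" "bar 5 = 5" "bar 6 = 6" "bar 7 = 7"
  "bar 8 = 1" "bar 9 = 2" "bar 10 = 3" "bar 11 = 4" "bar 12 = 5" "bar 13 = 6" "bar 14 = 7"
  by (simp_all add: bar_def)

lemma letter_cases:
  obtains "l = px" | "l = nx" | b where "l = (Y, b)" | b where "l = (T, b)"
  by (cases l; cases "fst l"; cases "snd l") auto

text \<open>A finite check. The third claim says that the action respects the pairs {m, m + 7} and
  so descends to the points of the plane.\<close>

lemma letter_act_props:
  assumes "i \<in> {1..14}"
  shows "letter_act l i \<in> {1..14}"
    and "letter_act (fst l, \<not> snd l) (letter_act l i) = i"
    and "bar (letter_act l i) = bar (letter_act l (bar i))"
proof -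
  have "\<forall>i \<in> {1, 2, 3, 4, 5, 6, 7, 8, 9, 10, 11, 12, 13, 14}.
      letter_act l i \<in> {1..14} \<and> letter_act (fst l, \<not> snd l) (letter_act l i) = i \<and>
      bar (letter_act l i) = bar (letter_act l (bar i))"
    by (cases l rule: letter_cases)
      (simp_all add: letter_act_table bar_table del: One_nat_def letter_act.simps(1-3))
  then show "letter_act l i \<in> {1..14}" "letter_act (fst l, \<not> snd l) (letter_act l i) = i"
    "bar (letter_act l i) = bar (letter_act l (bar i))"
    using assms unfolding atLeastAtMost_1_14 by blast+
qed

lemma act_in_range: "i \<in> {1..14} \<Longrightarrow> act i w \<in> {1..14}"
  by (induction w arbitrary: i) (simp_all only: act_Nil act_Cons letter_act_props(1))

lemma act_inv_word: "i \<in> {1..14} \<Longrightarrow> act (act i w) (inv_word w) = i"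
proof (induction w arbitrary: i)
  case (Cons l w)
  have inv: "inv_word (l # w) = inv_word w @ [(fst l, \<not> snd l)]"
    by (simp add: inv_word_def split_def)
  show ?case
    unfolding inv act_append act_Cons act_Nil
    by (simp only: Cons.IH letter_act_props[OF Cons.prems])
qed (simp add: inv_word_def)

text \<open>On points x is the 7-cycle and y is (1 5)(2 3); inspection of the seven lines shows that
  both are collineations.\<close>

lemma fano_lines_letter_act:
  assumes "L \<in> fano_lines" "fst l \<noteq> T"
  shows "(\<lambda>m. bar (letter_act l m)) ` L \<in> fano_lines"
proof -
  have "\<forall>L \<in> fano_lines. (\<lambda>m. bar (letter_act l m)) ` L \<in> fano_lines"
    using assms(2)
    by (cases l rule: letter_cases)
      (simp_all add: letter_act_table bar_table fano_lines_def set_eq_subset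
        del: One_nat_def letter_act.simps(1-3))
  with assms(1) show ?thesis by blast
qed

lemma fano_lines_act:
  assumes "{bar i, bar j, bar k} \<in> fano_lines" "N_word w"
    and "i \<in> {1..14}" "j \<in> {1..14}" "k \<in> {1..14}"
  shows "{bar (act i w), bar (act j w), bar (act k w)} \<in> fano_lines"
  using assms
proof (induction w arbitrary: i j k)
  case (Cons l w)
  have "fst l \<noteq> T" "N_word w" using Cons.prems(2) by (auto simp: N_word_def)
  moreover from fano_lines_letter_act[OF Cons.prems(1) this(1)]
  have "{bar (letter_act l i), bar (letter_act l j), bar (letter_act l k)} \<in> fano_lines"
    using Cons.prems(3-5) by (simp only: image_insert image_empty letter_act_props(3)[of _ l])
  ultimately show ?case
    unfolding act_Cons using Cons.prems(3-5) by (intro Cons.IH letter_act_props(1))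
qed (simp only: act_Nil)

lemma N_transitive:
  assumes "i \<in> {1..14}"
  shows "\<exists>c. N_word c \<and> act i c = 7"
proof -
  have "i \<in> {1, 2, 3, 4, 5, 6, 7, 8, 9, 10, 11, 12, 13, 14}"
    using assms unfolding atLeastAtMost_1_14 .
  \<comment> \<open>A power of x takes i \<le> 7 to 7. For i \<ge> 8, a power of x^-1 takes i to 8,
    then y takes 8 to 5 and x^2 takes 5 to 7.\<close>
  then have "act i (if i \<le> 7 then replicate (7 - i) px else replicate (i - 8) nx @ [py, px, px]) = 7"
    by (elim insertE emptyE)
      (simp_all add: eval_nat_numeral act_Cons xperm_def xperm_inv_def yperm_def)
  then show ?thesis
    by (intro exI[of _ "if i \<le> 7 then replicate (7 - i) px else replicate (i - 8) nx @ [py, px, px]"])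
      (auto simp: N_word_def)
qed

lemma N_stabilizer_transitive:
  assumes "i \<in> {1..14}" "bar i \<noteq> 7"
  shows "\<exists>c. N_word c \<and> act 7 c = 7 \<and> act i c = 1"
proof -
  \<comment> \<open>\<open>?b\<close> is x^2 y x^-3, which fixes 7 as y does, and \<open>?b'\<close>
    is its inverse. The twelve words below take to 1 the twelve indices not lying over 7, one word
    for each.\<close>
  let ?b = "[px, px, py, nx, nx, nx]" and ?b' = "[px, px, px, py, nx, nx]"
  have "i \<in> {1, 2, 3, 4, 5, 6, 7, 8, 9, 10, 11, 12, 13, 14}"
    using assms(1) unfolding atLeastAtMost_1_14 .
  then have "\<exists>c \<in> {[], [py], ?b, ?b', py # ?b, py # ?b', ?b @ [py], ?b' @ [py], py # ?b @ [py],
      py # ?b' @ [py], ?b @ py # ?b', ?b' @ py # ?b}. act 7 c = 7 \<and> act i c = 1"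
    using assms(2)
    by (elim insertE emptyE)
      (simp_all add: act_Cons act_append letter_act_table bar_def del: One_nat_def letter_act.simps(1-3))
  moreover have "N_word c" if "c \<in> {[], [py], ?b, ?b', py # ?b, py # ?b', ?b @ [py], ?b' @ [py],
      py # ?b @ [py], py # ?b' @ [py], ?b @ py # ?b', ?b' @ py # ?b}" for c
    using that by (auto simp: N_word_def)
  ultimately show ?thesis by blast
qed

text \<open>Every line has three distinct points, and {7, 1, 5} is the only line through 7 and
  1.\<close>

lemma fano_lines_7:
  "{7, a, b} \<in> fano_lines \<Longrightarrow> a \<noteq> 7"
  "{7, 1, b} \<in> fano_lines \<Longrightarrow> b = 5"
proof -
  assume "{7, a, b} \<in> fano_lines"
  then show "a \<noteq> 7"
    by (intro notI) (simp add: fano_lines_def set_eq_subset, elim disjE conjE; simp)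
next
  assume "{7, 1, b} \<in> fano_lines"
  then show "b = 5"
    by (simp add: fano_lines_def set_eq_subset del: One_nat_def)
qed

text \<open>First i is moved to 7, then j to 1 inside the stabilizer of 7. Collinearity is preserved
  and forces k to end over the point 5, that is, at 5 or 12.\<close>

lemma fano_normal_form:
  assumes "{bar i, bar j, bar k} \<in> fano_lines"
    and i: "i \<in> {1..14}" and j: "j \<in> {1..14}" and k: "k \<in> {1..14}"
  shows "\<exists>c. N_word c \<and> act i c = 7 \<and> act j c = 1 \<and> act k c \<in> {5, 12}"
proof -
  obtain c where c: "N_word c" "act i c = 7" using N_transitive[OF i] by blast
  have "{7, bar (act j c), bar (act k c)} \<in> fano_lines"
    using fano_lines_act[OF assms(1) c(1) i j k] by (simp only: c bar_table)
  then have "bar (act j c) \<noteq> 7"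
    using fano_lines_7(1) by blast
  then obtain d where d: "N_word d" "act 7 d = 7" "act (act j c) d = 1"
    using N_stabilizer_transitive[OF act_in_range[OF j]] by blast
  have cd: "N_word (c @ d)" "act i (c @ d) = 7" "act j (c @ d) = 1"
    using c d by (simp_all add: act_append)
  have "{7, 1, bar (act k (c @ d))} \<in> fano_lines"
    using fano_lines_act[OF assms(1) cd(1) i j k] by (simp only: cd bar_table)
  then have "bar (act k (c @ d)) = 5"
    by (rule fano_lines_7(2))
  then have "act k (c @ d) \<in> {5, 12}"
    using act_in_range[OF k] by (auto simp: bar_def split: if_splits)
  with cd show ?thesis by blast
qed

theorem theorem3p8:
  fixes i j k :: nat and gi gj gk :: word
  assumes "i \<in> {1..14}" "j \<in> {1..14}" "k \<in> {1..14}"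
    and "bar i \<noteq> bar j" "bar j \<noteq> bar k" "bar i \<noteq> bar k"
    and "{bar i, bar j, bar k} \<in> fano_lines"
    and "N_word gi" "act 7 gi = i"
    and "N_word gj" "act 7 gj = j"
    and "N_word gk" "act 7 gk = k"
  shows "\<exists>\<gamma>. N_word \<gamma> \<and>
           geq \<gamma> (t_of gi @ t_of gj @ t_of gk @ t_of gi @ t_of gj)"
proof -
  obtain c where c: "N_word c" "act i c = 7" "act j c = 1" "act k c \<in> {5, 12}"
    using fano_normal_form[OF assms(7,1-3)] by blast
  let ?u = "[i, j, k, i, j]"
  have chain: "coset_eq [] (map (\<lambda>m. act m c) ?u)"
    using coset_eq_move_chains c by auto
  \<comment> \<open>The inverse of c undoes the relabelling and leaves the empty word alone, so the
    relation for the normal form returns to the given triple.\<close>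
  from coset_eq_act[OF chain, of "inv_word c"] c(1)
  have "coset_eq [] (map (\<lambda>m. act m (inv_word c)) (map (\<lambda>m. act m c) ?u))"
    by simp
  then have "coset_eq ?u []"
    using assms(1-3) by (simp add: act_inv_word coset_eq_sym)
  then obtain w where "N_word w" "prods ?u = val w"
    by (auto simp: coset_eq_def)
  moreover have "val (t_of gi @ t_of gj @ t_of gk @ t_of gi @ t_of gj) = prods ?u"
    by (simp add: val_t_of[OF assms(8,9)] val_t_of[OF assms(10,11)] val_t_of[OF assms(12,13)])
  ultimately show ?thesis
    using val_eq_iff by metis
qed

end
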